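(* For every odd prime $p$, the clique number of $G_p$ is $$\omega(G_p)=p+1.$$
   Context: For $n\ge2$, $\mathbb{L}_n=\{a+bi+cj+dk: a,b,c,d\in\mathbb{Z}/n\mathbb{Z}\}$ is the ring of Lipschitz quaternions modulo $n$, with the usual relations $i^2=j^2=k^2=-1$, $ij=k=-ji$, $jk=i=-kj$, $ki=j=-ik$ taken modulo $n$. A nonzero element $x$ of a ring is a zero divisor if $xy=0$ or $yx=0$ for some nonzero $y$. $G_n=\Gamma(\mathbb{L}_n)$ is the simple undirected graph whose vertices are the nonzero zero divisors of $\mathbb{L}_n$, distinct $x,y$ being adjacent iff $xy=0$ or $yx=0$. (For odd primes $p$, $\mathbb{L}_p\cong M_2(\mathbb{F}_p)$.) $\omega(G)$ is the maximum order of a clique of $G$. *)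

theory Defs
  imports
    "HOL-Number_Theory.Residues"
    "HOL-Library.Ramsey"
begin

datatype 'a quat = Quat (quat_re: 'a) (quat_i: 'a) (quat_j: 'a) (quat_k: 'a)

text \<open>\<open>Quat a b c d\<close> stands for \<open>a + b i + c j + d k\<close>; the multiplication is the bilinear
  extension of \<open>i\<^sup>2 = j\<^sup>2 = k\<^sup>2 = -1\<close>, \<open>i j = k = - j i\<close>, \<open>j k = i = - k j\<close>,
  \<open>k i = j = - i k\<close>.\<close>

definition quat_mult :: "('a, 'b) ring_scheme \<Rightarrow> 'a quat \<Rightarrow> 'a quat \<Rightarrow> 'a quat" where
  "quat_mult R x y = (case (x, y) of (Quat a b c d, Quat a' b' c' d') \<Rightarrow>
     Quat (a \<otimes>\<^bsub>R\<^esub> a' \<ominus>\<^bsub>R\<^esub> b \<otimes>\<^bsub>R\<^esub> b' \<ominus>\<^bsub>R\<^esub> c \<otimes>\<^bsub>R\<^esub> c' \<ominus>\<^bsub>R\<^esub> d \<otimes>\<^bsub>R\<^esub> d')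
          (a \<otimes>\<^bsub>R\<^esub> b' \<oplus>\<^bsub>R\<^esub> b \<otimes>\<^bsub>R\<^esub> a' \<oplus>\<^bsub>R\<^esub> c \<otimes>\<^bsub>R\<^esub> d' \<ominus>\<^bsub>R\<^esub> d \<otimes>\<^bsub>R\<^esub> c')
          (a \<otimes>\<^bsub>R\<^esub> c' \<ominus>\<^bsub>R\<^esub> b \<otimes>\<^bsub>R\<^esub> d' \<oplus>\<^bsub>R\<^esub> c \<otimes>\<^bsub>R\<^esub> a' \<oplus>\<^bsub>R\<^esub> d \<otimes>\<^bsub>R\<^esub> b')
          (a \<otimes>\<^bsub>R\<^esub> d' \<oplus>\<^bsub>R\<^esub> b \<otimes>\<^bsub>R\<^esub> c' \<ominus>\<^bsub>R\<^esub> c \<otimes>\<^bsub>R\<^esub> b' \<oplus>\<^bsub>R\<^esub> d \<otimes>\<^bsub>R\<^esub> a'))"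

definition quat_add :: "('a, 'b) ring_scheme \<Rightarrow> 'a quat \<Rightarrow> 'a quat \<Rightarrow> 'a quat" where
  "quat_add R x y = (case (x, y) of (Quat a b c d, Quat a' b' c' d') \<Rightarrow>
     Quat (a \<oplus>\<^bsub>R\<^esub> a') (b \<oplus>\<^bsub>R\<^esub> b') (c \<oplus>\<^bsub>R\<^esub> c') (d \<oplus>\<^bsub>R\<^esub> d'))"

definition quat_ring :: "('a, 'b) ring_scheme \<Rightarrow> 'a quat ring" where
  "quat_ring R =
     \<lparr>carrier = {x. set_quat x \<subseteq> carrier R},
      monoid.mult = quat_mult R,
      one = Quat \<one>\<^bsub>R\<^esub> \<zero>\<^bsub>R\<^esub> \<zero>\<^bsub>R\<^esub> \<zero>\<^bsub>R\<^esub>,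
      zero = Quat \<zero>\<^bsub>R\<^esub> \<zero>\<^bsub>R\<^esub> \<zero>\<^bsub>R\<^esub> \<zero>\<^bsub>R\<^esub>,
      add = quat_add R\<rparr>"

definition lipschitz_quat_mod :: "nat \<Rightarrow> int quat ring" where
  "lipschitz_quat_mod n = quat_ring (residue_ring (int n))"

text \<open>Here \<open>\<zero>\<close> is not a zero divisor, and a one-sided zero divisor counts as one. The graph is given by its
  vertex set and a set of two-element edges, so that it fits the library's \<^const>\<open>clique\<close>.\<close>

definition zero_divisors :: "('a, 'b) ring_scheme \<Rightarrow> 'a set" where
  "zero_divisors R = {x \<in> carrier R. x \<noteq> \<zero>\<^bsub>R\<^esub> \<and>
     (\<exists>y \<in> carrier R. y \<noteq> \<zero>\<^bsub>R\<^esub> \<and> (x \<otimes>\<^bsub>R\<^esub> y = \<zero>\<^bsub>R\<^esub> \<or> y \<otimes>\<^bsub>R\<^esub> x = \<zero>\<^bsub>R\<^esub>))}"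

definition zero_divisor_edges :: "('a, 'b) ring_scheme \<Rightarrow> 'a set set" where
  "zero_divisor_edges R = {{x, y} | x y. x \<in> zero_divisors R \<and> y \<in> zero_divisors R \<and> x \<noteq> y \<and>
     (x \<otimes>\<^bsub>R\<^esub> y = \<zero>\<^bsub>R\<^esub> \<or> y \<otimes>\<^bsub>R\<^esub> x = \<zero>\<^bsub>R\<^esub>)}"

text \<open>Meaningful for finite \<open>V\<close> only.\<close>

definition clique_number :: "'a set \<Rightarrow> 'a set set \<Rightarrow> nat" where
  "clique_number V E = Max {card C | C. C \<subseteq> V \<and> clique C E}"

lemma quat_ring_is_ring:
  assumes "cring R"
  shows "ring (quat_ring R)"
proof -
  interpret cring R by fact
  show ?thesis
  proof (intro ringI abelian_groupI monoidI, goal_cases)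
    case (6 x)
    then show ?case
      by (intro bexI[of _ "map_quat (a_inv R) x"])
        (cases x; auto simp: quat_ring_def quat_add_def l_neg)+
  next
    case (9 x y z)
    then show ?case
      apply (cases x; cases y; cases z)
      apply (simp add: quat_ring_def quat_mult_def quat_add_def minus_eq
          l_distr r_distr l_minus r_minus minus_add m_assoc)
      apply (intro conjI; simp add: a_ac)
      done
  next
    case (12 x y z)
    then show ?case
      apply (cases x; cases y; cases z)
      apply (simp add: quat_ring_def quat_mult_def quat_add_def minus_eq
          l_distr r_distr l_minus r_minus minus_add m_assoc)
      apply (intro conjI; simp add: a_ac)
      done
  next
    case (13 x y z)
    then show ?case
      apply (cases x; cases y; cases z)
      apply (simp add: quat_ring_def quat_mult_def quat_add_def minus_eq
          l_distr r_distr l_minus r_minus minus_add m_assoc)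
      apply (intro conjI; simp add: a_ac)
      done
  qed (auto simp: quat_ring_def quat_mult_def quat_add_def a_ac minus_eq split: quat.splits)
qed

lemma quat_ring_relations:
  fixes R (structure)
  assumes "cring R"
  defines "Q \<equiv> quat_ring R"
    and "i \<equiv> Quat \<zero> \<one> \<zero> \<zero>" and "j \<equiv> Quat \<zero> \<zero> \<one> \<zero>" and "k \<equiv> Quat \<zero> \<zero> \<zero> \<one>"
  shows "i \<otimes>\<^bsub>Q\<^esub> i = \<ominus>\<^bsub>Q\<^esub> \<one>\<^bsub>Q\<^esub>" "j \<otimes>\<^bsub>Q\<^esub> j = \<ominus>\<^bsub>Q\<^esub> \<one>\<^bsub>Q\<^esub>" "k \<otimes>\<^bsub>Q\<^esub> k = \<ominus>\<^bsub>Q\<^esub> \<one>\<^bsub>Q\<^esub>"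
    and "i \<otimes>\<^bsub>Q\<^esub> j = k" "j \<otimes>\<^bsub>Q\<^esub> i = \<ominus>\<^bsub>Q\<^esub> k"
    and "j \<otimes>\<^bsub>Q\<^esub> k = i" "k \<otimes>\<^bsub>Q\<^esub> j = \<ominus>\<^bsub>Q\<^esub> i"
    and "k \<otimes>\<^bsub>Q\<^esub> i = j" "i \<otimes>\<^bsub>Q\<^esub> k = \<ominus>\<^bsub>Q\<^esub> j"
proof -
  interpret cring R by fact
  interpret Q: ring Q unfolding Q_def by (rule quat_ring_is_ring) fact
  have minus: "\<ominus>\<^bsub>Q\<^esub> Quat a b c d = Quat (\<ominus> a) (\<ominus> b) (\<ominus> c) (\<ominus> d)"
    if "{a, b, c, d} \<subseteq> carrier R" for a b c d
    by (rule Q.minus_equality)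
      (use that in \<open>auto simp: Q_def quat_ring_def quat_add_def l_neg\<close>)
  have one: "\<one>\<^bsub>Q\<^esub> = Quat \<one> \<zero> \<zero> \<zero>" by (simp add: Q_def quat_ring_def)
  have mult: "x \<otimes>\<^bsub>Q\<^esub> y = quat_mult R x y" for x y by (simp add: Q_def quat_ring_def)
  show "i \<otimes>\<^bsub>Q\<^esub> i = \<ominus>\<^bsub>Q\<^esub> \<one>\<^bsub>Q\<^esub>" "j \<otimes>\<^bsub>Q\<^esub> j = \<ominus>\<^bsub>Q\<^esub> \<one>\<^bsub>Q\<^esub>" "k \<otimes>\<^bsub>Q\<^esub> k = \<ominus>\<^bsub>Q\<^esub> \<one>\<^bsub>Q\<^esub>"
    "i \<otimes>\<^bsub>Q\<^esub> j = k" "j \<otimes>\<^bsub>Q\<^esub> i = \<ominus>\<^bsub>Q\<^esub> k"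
    "j \<otimes>\<^bsub>Q\<^esub> k = i" "k \<otimes>\<^bsub>Q\<^esub> j = \<ominus>\<^bsub>Q\<^esub> i"
    "k \<otimes>\<^bsub>Q\<^esub> i = j" "i \<otimes>\<^bsub>Q\<^esub> k = \<ominus>\<^bsub>Q\<^esub> j"
    by (simp_all add: mult one minus i_def j_def k_def quat_mult_def minus_eq)
qed

lemma finite_zero_divisors_lipschitz: "finite (zero_divisors (lipschitz_quat_mod n))"
proof (rule finite_subset)
  let ?A = "{0..int n - 1}"
  show "zero_divisors (lipschitz_quat_mod n)
      \<subseteq> (\<lambda>(a, b, c, d). Quat a b c d) ` (?A \<times> ?A \<times> ?A \<times> ?A)"
  proof
    fix x assume "x \<in> zero_divisors (lipschitz_quat_mod n)"
    then show "x \<in> (\<lambda>(a, b, c, d). Quat a b c d) ` (?A \<times> ?A \<times> ?A \<times> ?A)"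
      by (cases x) (auto simp: zero_divisors_def lipschitz_quat_mod_def quat_ring_def
          residue_ring_def image_iff)
  qed
qed simp

end

theory Submission
  imports Defs
begin

text \<open>
  Over a field of odd characteristic with \<open>q\<close> elements the quaternions are the \<open>2 \<times> 2\<close> matrices,
  and the zero divisors are the matrices of rank one. Such a matrix has a kernel and an image, both
  lines, and \<open>x y = 0\<close> holds iff the image of \<open>y\<close> is the kernel of \<open>x\<close>. Two consequences control all
  cliques:

  \<^item> The relation \<open>x y = 0\<close> is rectangular: if \<open>x y = x z = w y = 0\<close>, then \<open>w z = 0\<close>, because \<open>y\<close> and
    \<open>z\<close> have the same image and \<open>x\<close> and \<open>w\<close> the same kernel.
  \<^item> A rank one matrix is determined up to a scalar by its kernel and its image.

  By rectangularity, each member \<open>x\<close> of a clique has at most one \<open>y\<close> with \<open>x y = 0 \<noteq> y\<^sup>2\<close> in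
  the clique, and at most one with \<open>y x = 0 \<noteq> y\<^sup>2\<close>. The members of square zero annihilate each other
  on both sides, so all have the same kernel and image and number at most \<open>q - 1\<close>. Taking \<open>x\<close> of
  square zero gives at most \<open>(q - 1) + 2\<close> members; if there is no such \<open>x\<close>, any member as \<open>x\<close> gives at
  most \<open>1 + 2\<close>.

  The bound is attained: if \<open>b\<^sup>2 + c\<^sup>2 + 1 = 0\<close>, then \<open>x = b i + c j + k\<close> has square zero, and its nonzero
  multiples together with \<open>x k\<close> and \<open>k x\<close> form a clique.

  The proof uses no isomorphism with matrices. Kernels and images are replaced by
  conjugation: \<open>y\<close> and \<open>z\<close> of rank one have the same image iff \<open>conj y * z = 0\<close>, and
  \<open>conj_mult_eq_zero\<close> obtains this from a common nonzero left annihilator. Conjugating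
  exchanges left and right, and the two properties \<open>mult_eq_zero_rectangular\<close> and
  \<open>proportional_if_same_annihilators\<close> follow.
\<close>

section \<open>Cliques of a rectangular relation\<close>

text \<open>
  Two loop-free out-neighbours \<open>y\<close>, \<open>z\<close> of a member \<open>x\<close> cannot both belong to the clique: from
  \<open>Z x y\<close>, \<open>Z x z\<close> and \<open>Z y z\<close>, rectangularity gives \<open>Z y y\<close>. The same holds for in-neighbours.
  Every member other than \<open>x\<close> is a neighbour of \<open>x\<close>, so only loops can be numerous.
\<close>

lemma card_rectangular_clique_le:
  assumes fin: "finite C"
    and clique: "\<And>x y. x \<in> C \<Longrightarrow> y \<in> C \<Longrightarrow> x \<noteq> y \<Longrightarrow> Z x y \<or> Z y x"
    and rect: "\<And>x y z w. x \<in> C \<Longrightarrow> y \<in> C \<Longrightarrow> z \<in> C \<Longrightarrow> w \<in> C \<Longrightarrow>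
      Z x y \<Longrightarrow> Z x z \<Longrightarrow> Z w y \<Longrightarrow> Z w z"
    and loops: "card {x \<in> C. Z x x} \<le> m" and "1 \<le> m"
  shows "card C \<le> m + 2"
proof -
  let ?L = "{x \<in> C. Z x x}"
  let ?out = "\<lambda>x. {y \<in> C. \<not> Z y y \<and> Z x y}" and ?in = "\<lambda>x. {y \<in> C. \<not> Z y y \<and> Z y x}"
  have out: "card (?out x) \<le> 1" if "x \<in> C" for x
  proof -
    have "y = z" if "y \<in> ?out x" "z \<in> ?out x" for y z
      using that \<open>x \<in> C\<close> clique[of y z] rect[of x y z z] rect[of x z y y] by blast
    then show ?thesis using fin by (auto simp: card_le_Suc0_iff_eq)
  qed
  have "in": "card (?in x) \<le> 1" if "x \<in> C" for x
  proof -
    have "y = z" if "y \<in> ?in x" "z \<in> ?in x" for y z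
      using that \<open>x \<in> C\<close> clique[of y z] rect[of y x z z] rect[of z x y y] by blast
    then show ?thesis using fin by (auto simp: card_le_Suc0_iff_eq)
  qed
  \<comment> \<open>With \<open>A\<close> the set of loops, or \<open>A = {x}\<close> if there are none.\<close>
  have bound: "card C \<le> n + 2" if "x \<in> C" "C \<subseteq> A \<union> (?out x \<union> ?in x)" "finite A" "card A \<le> n" for x A n
  proof -
    have "card C \<le> card (A \<union> (?out x \<union> ?in x))"
      using that fin by (intro card_mono) auto
    also have "\<dots> \<le> card A + (card (?out x) + card (?in x))"
      by (meson card_Un_le add_left_mono le_trans)
    also have "\<dots> \<le> n + 2"
      using that(4) out[OF that(1)] "in"[OF that(1)] by linarith
    finally show ?thesis .
  qed
  show ?thesis
  proof (cases "?L = {}")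
    case False
    then obtain x where "x \<in> C" "Z x x" by blast
    then show ?thesis
      using clique fin loops by (intro bound[of x ?L]) auto
  next
    case no_loops: True
    show ?thesis
    proof (cases "C = {}")
      case False
      then obtain x where "x \<in> C" by blast
      then show ?thesis
        using clique no_loops \<open>1 \<le> m\<close> by (intro bound[of x "{x}"]) auto
    qed simp
  qed
qed

section \<open>Minus one as a sum of two squares\<close>

text \<open>Squaring has fibres of at most two elements, and the fibre of zero is a singleton; the latter
  makes the inequality strict.\<close>

lemma (in field) card_carrier_less_twice_squares:
  assumes fin: "finite (carrier R)"
  shows "card (carrier R) < 2 * card ((\<lambda>a. a \<otimes> a) ` carrier R)"
proof -
  let ?S = "(\<lambda>a. a \<otimes> a) ` carrier R"
  let ?F = "\<lambda>s. {a \<in> carrier R. a \<otimes> a = s}"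
  have zero: "\<zero> \<in> ?S" by (auto intro!: image_eqI[of _ _ \<zero>])
  have "?F \<zero> = {\<zero>}" by (auto simp: integral_iff)
  have fibre: "card (?F s) \<le> 2" if "s \<in> ?S" for s
  proof -
    from that obtain a where a: "a \<in> carrier R" "s = a \<otimes> a" by blast
    have "b = a \<or> b = \<ominus> a" if b: "b \<in> carrier R" "b \<otimes> b = a \<otimes> a" for b
    proof -
      have "(b \<ominus> a) \<otimes> (b \<oplus> a) = (b \<otimes> b \<oplus> \<ominus> (b \<otimes> a)) \<oplus> (b \<otimes> a \<oplus> \<ominus> (a \<otimes> a))"
        using a(1) b(1) by (simp add: minus_eq l_distr r_distr l_minus minus_add m_comm[of a b])
      also have "\<dots> = b \<otimes> b \<ominus> a \<otimes> a"
        using a(1) b(1) by (simp add: minus_eq a_assoc r_neg1)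
      also have "\<dots> = \<zero>" using a(1) by (simp add: b(2) r_neg minus_eq)
      finally have "b \<ominus> a = \<zero> \<or> b \<oplus> a = \<zero>"
        using a(1) b(1) integral_iff[of "b \<ominus> a" "b \<oplus> a"] by auto
      then show ?thesis
        using a b(1) minus_equality[of b a] r_right_minus_eq[of b a] by auto
    qed
    then have "?F s \<subseteq> {a, \<ominus> a}" using a by auto
    then have "card (?F s) \<le> card {a, \<ominus> a}" by (intro card_mono) auto
    also have "\<dots> \<le> 2" by (simp add: card_insert_if)
    finally show ?thesis .
  qed
  have "carrier R = (\<Union>s\<in>?S. ?F s)" by auto
  then have "card (carrier R) = card (\<Union>s\<in>?S. ?F s)" by simp
  also have "\<dots> = (\<Sum>s\<in>?S. card (?F s))"
    using fin by (intro card_UN_disjoint) auto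
  also have "\<dots> = card (?F \<zero>) + (\<Sum>s\<in>?S - {\<zero>}. card (?F s))"
    using fin zero by (intro sum.remove) auto
  also have "\<dots> \<le> 1 + (\<Sum>s\<in>?S - {\<zero>}. 2)"
    using \<open>?F \<zero> = {\<zero>}\<close> fibre by (intro add_mono sum_mono) auto
  also have "\<dots> = 1 + 2 * (card ?S - 1)" using fin zero by simp
  also have "\<dots> < 2 * card ?S"
    using fin zero card_gt_0_iff[of ?S] by auto
  finally show ?thesis .
qed

text \<open>The squares \<open>b\<^sup>2\<close> and the elements \<open>- (c\<^sup>2 + 1)\<close> each make up more than half of the field, so the two
  sets meet.\<close>

lemma (in field) ex_two_squares_plus_one:
  assumes fin: "finite (carrier R)"
  obtains b c where "b \<in> carrier R" "c \<in> carrier R" "b \<otimes> b \<oplus> c \<otimes> c \<oplus> \<one> = \<zero>"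
proof -
  let ?S = "(\<lambda>a. a \<otimes> a) ` carrier R"
  let ?T = "(\<lambda>s. \<ominus> (s \<oplus> \<one>)) ` ?S"
  have "inj_on (\<lambda>s. \<ominus> (s \<oplus> \<one>)) ?S"
    by (intro inj_onI) (metis (no_types, lifting) imageE m_closed add.m_closed one_closed minus_minus add.right_cancel)
  then have T: "card ?T = card ?S" by (rule card_image)
  have "?S \<inter> ?T \<noteq> {}"
  proof
    assume "?S \<inter> ?T = {}"
    then have "card ?S + card ?T = card (?S \<union> ?T)"
      using fin by (intro card_Un_disjoint[symmetric]) auto
    also have "\<dots> \<le> card (carrier R)" using fin by (intro card_mono) auto
    finally show False using T card_carrier_less_twice_squares[OF fin] by linarith
  qed
  then obtain b c where "b \<in> carrier R" "c \<in> carrier R" and eq: "b \<otimes> b = \<ominus> (c \<otimes> c \<oplus> \<one>)" by blast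
  moreover from this have "b \<otimes> b \<oplus> c \<otimes> c \<oplus> \<one> = \<zero>"
    using l_neg[of "c \<otimes> c \<oplus> \<one>"] by (simp add: a_assoc)
  ultimately show ?thesis using that by blast
qed

section \<open>Quaternions over a field of characteristic other than two\<close>

locale odd_field_quaternions = field R for R (structure) +
  assumes two_nonzero: "\<one> \<oplus> \<one> \<noteq> \<zero>"
begin

abbreviation Q where "Q \<equiv> quat_ring R"

sublocale Q: ring Q
  by (rule quat_ring_is_ring) (rule is_cring)

definition scalar :: "'a \<Rightarrow> 'a quat" where
  "scalar a = Quat a \<zero> \<zero> \<zero>"

fun quat_conj :: "'a quat \<Rightarrow> 'a quat" where
  "quat_conj (Quat a b c d) = Quat a (\<ominus> b) (\<ominus> c) (\<ominus> d)"

fun quat_trace :: "'a quat \<Rightarrow> 'a" where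
  "quat_trace (Quat a b c d) = a \<oplus> a"

fun quat_norm :: "'a quat \<Rightarrow> 'a" where
  "quat_norm (Quat a b c d) = a \<otimes> a \<oplus> b \<otimes> b \<oplus> c \<otimes> c \<oplus> d \<otimes> d"

lemma Q_simps [simp]:
  "x \<otimes>\<^bsub>Q\<^esub> y = quat_mult R x y" "x \<oplus>\<^bsub>Q\<^esub> y = quat_add R x y"
  "\<zero>\<^bsub>Q\<^esub> = Quat \<zero> \<zero> \<zero> \<zero>" "\<one>\<^bsub>Q\<^esub> = Quat \<one> \<zero> \<zero> \<zero>"
  "x \<in> carrier Q \<longleftrightarrow> set_quat x \<subseteq> carrier R"
  by (simp_all add: quat_ring_def)

lemmas coordinates = quat_mult_def quat_add_def scalar_def minus_eq
  l_distr r_distr l_minus r_minus minus_add m_ac a_ac r_neg l_neg r_neg1 r_neg2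

lemma add_neg_cancel:
  assumes "a \<in> carrier R" "b \<in> carrier R"
  shows "a \<oplus> (b \<oplus> (\<ominus> a \<oplus> \<ominus> b)) = \<zero>"
  using assms r_neg[of "a \<oplus> b"] by (simp add: minus_add a_assoc)

lemma scalar_closed: "a \<in> carrier R \<Longrightarrow> scalar a \<in> carrier Q"
  by (simp add: scalar_def)

lemma conj_closed: "x \<in> carrier Q \<Longrightarrow> quat_conj x \<in> carrier Q"
  by (cases x) simp

lemma trace_closed: "x \<in> carrier Q \<Longrightarrow> quat_trace x \<in> carrier R"
  by (cases x) simp

lemma norm_closed: "x \<in> carrier Q \<Longrightarrow> quat_norm x \<in> carrier R"
  by (cases x) simp

lemma scalar_eq_zero_iff: "scalar a = \<zero>\<^bsub>Q\<^esub> \<longleftrightarrow> a = \<zero>"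
  by (simp add: scalar_def)

lemma scalar_one: "scalar \<one> = \<one>\<^bsub>Q\<^esub>"
  by (simp add: scalar_def)

lemma scalar_mult:
  "a \<in> carrier R \<Longrightarrow> b \<in> carrier R \<Longrightarrow> scalar a \<otimes>\<^bsub>Q\<^esub> scalar b = scalar (a \<otimes> b)"
  by (simp add: coordinates)

lemma scalar_comm:
  "a \<in> carrier R \<Longrightarrow> x \<in> carrier Q \<Longrightarrow> scalar a \<otimes>\<^bsub>Q\<^esub> x = x \<otimes>\<^bsub>Q\<^esub> scalar a"
  by (cases x) (simp add: coordinates)

lemma conj_conj: "x \<in> carrier Q \<Longrightarrow> quat_conj (quat_conj x) = x"
  by (cases x) simp

lemma conj_zero: "quat_conj \<zero>\<^bsub>Q\<^esub> = \<zero>\<^bsub>Q\<^esub>"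
  by simp

lemma conj_add:
  "x \<in> carrier Q \<Longrightarrow> y \<in> carrier Q \<Longrightarrow> quat_conj (x \<oplus>\<^bsub>Q\<^esub> y) = quat_conj x \<oplus>\<^bsub>Q\<^esub> quat_conj y"
  by (cases x; cases y) (simp add: coordinates)

lemma conj_mult:
  "x \<in> carrier Q \<Longrightarrow> y \<in> carrier Q \<Longrightarrow> quat_conj (x \<otimes>\<^bsub>Q\<^esub> y) = quat_conj y \<otimes>\<^bsub>Q\<^esub> quat_conj x"
  by (cases x; cases y) (simp add: coordinates)

lemma add_conj: "x \<in> carrier Q \<Longrightarrow> x \<oplus>\<^bsub>Q\<^esub> quat_conj x = scalar (quat_trace x)"
  by (cases x) (simp add: coordinates)

lemma mult_conj: "x \<in> carrier Q \<Longrightarrow> x \<otimes>\<^bsub>Q\<^esub> quat_conj x = scalar (quat_norm x)"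
  by (cases x) (simp add: coordinates add_neg_cancel)

lemma conj_mult_self: "x \<in> carrier Q \<Longrightarrow> quat_conj x \<otimes>\<^bsub>Q\<^esub> x = scalar (quat_norm x)"
  by (cases x) (simp add: coordinates add_neg_cancel)

lemma double_eq_zero:
  assumes "a \<in> carrier R" "a \<oplus> a = \<zero>"
  shows "a = \<zero>"
proof -
  have "(\<one> \<oplus> \<one>) \<otimes> a = \<zero>" using assms by (simp add: l_distr)
  then show ?thesis using assms(1) two_nonzero by (simp add: integral_iff)
qed

text \<open>The traces of \<open>x\<close>, \<open>x i\<close>, \<open>x j\<close>, \<open>x k\<close> are, up to sign, twice the coordinates of \<open>x\<close>.\<close>

lemma trace_nondegenerate:
  assumes x: "x \<in> carrier Q" and tr: "\<And>u. u \<in> carrier Q \<Longrightarrow> quat_trace (x \<otimes>\<^bsub>Q\<^esub> u) = \<zero>"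
  shows "x = \<zero>\<^bsub>Q\<^esub>"
proof (cases x)
  case (Quat a b c d)
  then have abcd: "a \<in> carrier R" "b \<in> carrier R" "c \<in> carrier R" "d \<in> carrier R"
    using x by auto
  have "a = \<zero>"
    using tr[of "Quat \<one> \<zero> \<zero> \<zero>"] Quat abcd by - (rule double_eq_zero, auto simp: coordinates)
  moreover have "\<ominus> b = \<zero>"
    using tr[of "Quat \<zero> \<one> \<zero> \<zero>"] Quat abcd by - (rule double_eq_zero, auto simp: coordinates)
  moreover have "\<ominus> c = \<zero>"
    using tr[of "Quat \<zero> \<zero> \<one> \<zero>"] Quat abcd by - (rule double_eq_zero, auto simp: coordinates)
  moreover have "\<ominus> d = \<zero>"
    using tr[of "Quat \<zero> \<zero> \<zero> \<one>"] Quat abcd by - (rule double_eq_zero, auto simp: coordinates)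
  ultimately show ?thesis
    using Quat abcd by (metis Q_simps(3) minus_minus minus_zero)
qed

text \<open>From here on the arguments are coordinate-free, in the ring \<open>Q\<close>.\<close>

declare Q_simps [simp del]

lemma scalar_mult_eq_zero:
  assumes "a \<in> carrier R" "x \<in> carrier Q" "scalar a \<otimes>\<^bsub>Q\<^esub> x = \<zero>\<^bsub>Q\<^esub>" "a \<noteq> \<zero>"
  shows "x = \<zero>\<^bsub>Q\<^esub>"
proof -
  have inv: "inv a \<in> carrier R" "inv a \<otimes> a = \<one>" using assms by (auto simp: field_Units)
  then have "x = scalar (inv a \<otimes> a) \<otimes>\<^bsub>Q\<^esub> x"
    using assms(2) by (simp add: scalar_one)
  also have "\<dots> = scalar (inv a) \<otimes>\<^bsub>Q\<^esub> (scalar a \<otimes>\<^bsub>Q\<^esub> x)"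
    using assms(1,2) inv(1) by (simp add: scalar_closed Q.m_assoc flip: scalar_mult)
  also have "\<dots> = \<zero>\<^bsub>Q\<^esub>"
    using assms(3) inv(1) by (simp add: scalar_closed)
  finally show ?thesis .
qed

text \<open>\<open>x y = 0\<close> implies \<open>0 = x y (conj y) = norm y * x\<close>.\<close>

lemma norm_eq_zero:
  assumes "x \<in> carrier Q" "y \<in> carrier Q" "x \<noteq> \<zero>\<^bsub>Q\<^esub>" "x \<otimes>\<^bsub>Q\<^esub> y = \<zero>\<^bsub>Q\<^esub>"
  shows "quat_norm y = \<zero>"
proof (rule ccontr)
  assume "quat_norm y \<noteq> \<zero>"
  have "scalar (quat_norm y) \<otimes>\<^bsub>Q\<^esub> x = (x \<otimes>\<^bsub>Q\<^esub> y) \<otimes>\<^bsub>Q\<^esub> quat_conj y"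
    using assms(1,2) by (simp add: scalar_comm norm_closed conj_closed Q.m_assoc mult_conj)
  also have "\<dots> = \<zero>\<^bsub>Q\<^esub>" using assms by (simp add: conj_closed)
  finally show False
    using scalar_mult_eq_zero[of "quat_norm y" x] assms \<open>quat_norm y \<noteq> \<zero>\<close> by (simp add: norm_closed)
qed

text \<open>
  The elements annihilated by \<open>x\<close> from the left form a right ideal, on which the norm vanishes. Hence
  the polar form of the norm vanishes there too, in particular at \<open>(y, z u)\<close> for all \<open>u\<close>; its value is
  the trace of \<open>(conj y * z) u\<close>, and the trace form is nondegenerate.
\<close>

lemma conj_mult_eq_zero:
  assumes x: "x \<in> carrier Q" "x \<noteq> \<zero>\<^bsub>Q\<^esub>" and y: "y \<in> carrier Q" and z: "z \<in> carrier Q"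
    and xy: "x \<otimes>\<^bsub>Q\<^esub> y = \<zero>\<^bsub>Q\<^esub>" and xz: "x \<otimes>\<^bsub>Q\<^esub> z = \<zero>\<^bsub>Q\<^esub>"
  shows "quat_conj y \<otimes>\<^bsub>Q\<^esub> z = \<zero>\<^bsub>Q\<^esub>"
proof (rule trace_nondegenerate)
  show "quat_conj y \<otimes>\<^bsub>Q\<^esub> z \<in> carrier Q" using y z by (simp add: conj_closed)
  fix u assume u: "u \<in> carrier Q"
  define w where "w = z \<otimes>\<^bsub>Q\<^esub> u"
  have w: "w \<in> carrier Q" "x \<otimes>\<^bsub>Q\<^esub> w = \<zero>\<^bsub>Q\<^esub>"
    using x z u xz by (auto simp: w_def simp flip: Q.m_assoc)
  have null: "quat_conj s \<otimes>\<^bsub>Q\<^esub> s = \<zero>\<^bsub>Q\<^esub>" if "s \<in> carrier Q" "x \<otimes>\<^bsub>Q\<^esub> s = \<zero>\<^bsub>Q\<^esub>" for s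
    using norm_eq_zero[of x s] x that by (simp add: conj_mult_self scalar_eq_zero_iff)
  have "\<zero>\<^bsub>Q\<^esub> = quat_conj (y \<oplus>\<^bsub>Q\<^esub> w) \<otimes>\<^bsub>Q\<^esub> (y \<oplus>\<^bsub>Q\<^esub> w)"
    using x y w xy by (intro null[symmetric]) (simp_all add: Q.r_distr)
  also have "\<dots> = quat_conj y \<otimes>\<^bsub>Q\<^esub> w \<oplus>\<^bsub>Q\<^esub> quat_conj w \<otimes>\<^bsub>Q\<^esub> y"
    using y w xy by (simp add: conj_add conj_closed Q.l_distr Q.r_distr Q.a_comm null)
  also have "\<dots> = quat_conj y \<otimes>\<^bsub>Q\<^esub> w \<oplus>\<^bsub>Q\<^esub> quat_conj (quat_conj y \<otimes>\<^bsub>Q\<^esub> w)"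
    using y w by (simp add: conj_mult conj_closed conj_conj)
  also have "\<dots> = scalar (quat_trace (quat_conj y \<otimes>\<^bsub>Q\<^esub> w))"
    using y w by (simp add: add_conj conj_closed)
  finally have "quat_trace (quat_conj y \<otimes>\<^bsub>Q\<^esub> w) = \<zero>"
    using scalar_eq_zero_iff by metis
  then show "quat_trace (quat_conj y \<otimes>\<^bsub>Q\<^esub> z \<otimes>\<^bsub>Q\<^esub> u) = \<zero>"
    using y z u by (simp add: w_def Q.m_assoc conj_closed)
qed

text \<open>The common left annihilator \<open>x\<close> of \<open>y\<close> and \<open>z\<close> gives \<open>conj y * z = 0\<close>. As \<open>conj y\<close> also annihilates
  \<open>conj w\<close>, it is a common left annihilator of \<open>conj w\<close> and \<open>z\<close>, and the same step applies again.\<close>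

lemma mult_eq_zero_rectangular:
  assumes x: "x \<in> carrier Q" "x \<noteq> \<zero>\<^bsub>Q\<^esub>" and y: "y \<in> carrier Q" "y \<noteq> \<zero>\<^bsub>Q\<^esub>"
    and z: "z \<in> carrier Q" and w: "w \<in> carrier Q"
    and zeros: "x \<otimes>\<^bsub>Q\<^esub> y = \<zero>\<^bsub>Q\<^esub>" "x \<otimes>\<^bsub>Q\<^esub> z = \<zero>\<^bsub>Q\<^esub>" "w \<otimes>\<^bsub>Q\<^esub> y = \<zero>\<^bsub>Q\<^esub>"
  shows "w \<otimes>\<^bsub>Q\<^esub> z = \<zero>\<^bsub>Q\<^esub>"
proof -
  have "quat_conj y \<noteq> \<zero>\<^bsub>Q\<^esub>" using y by (metis conj_conj conj_zero)
  moreover have "quat_conj y \<otimes>\<^bsub>Q\<^esub> quat_conj w = \<zero>\<^bsub>Q\<^esub>"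
    using y w zeros(3) by (simp add: conj_zero flip: conj_mult)
  moreover have "quat_conj y \<otimes>\<^bsub>Q\<^esub> z = \<zero>\<^bsub>Q\<^esub>"
    by (rule conj_mult_eq_zero[OF x y(1) z zeros(1,2)])
  ultimately have "quat_conj (quat_conj w) \<otimes>\<^bsub>Q\<^esub> z = \<zero>\<^bsub>Q\<^esub>"
    using y(1) z w conj_mult_eq_zero[of "quat_conj y" "quat_conj w" z] by (simp add: conj_closed)
  then show ?thesis using w by (simp add: conj_conj)
qed

text \<open>
  The hypotheses give \<open>conj y * z = 0\<close> and \<open>y * conj z = 0\<close>. Then \<open>y u z\<close> is a multiple of \<open>z\<close> and of
  \<open>y\<close> at once: adding \<open>conj u * conj y * z = 0\<close> turns it into \<open>trace (y u) * z\<close>, and adding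
  \<open>y * conj z * conj u = 0\<close> turns it into \<open>trace (u z) * y\<close>. It remains to choose \<open>u\<close> such that
  \<open>trace (y u) \<noteq> 0\<close>.
\<close>

lemma proportional_if_same_annihilators:
  assumes x: "x \<in> carrier Q" "x \<noteq> \<zero>\<^bsub>Q\<^esub>" and y: "y \<in> carrier Q" "y \<noteq> \<zero>\<^bsub>Q\<^esub>"
    and z: "z \<in> carrier Q" and w: "w \<in> carrier Q" "w \<noteq> \<zero>\<^bsub>Q\<^esub>"
    and left: "x \<otimes>\<^bsub>Q\<^esub> y = \<zero>\<^bsub>Q\<^esub>" "x \<otimes>\<^bsub>Q\<^esub> z = \<zero>\<^bsub>Q\<^esub>"
    and right: "y \<otimes>\<^bsub>Q\<^esub> w = \<zero>\<^bsub>Q\<^esub>" "z \<otimes>\<^bsub>Q\<^esub> w = \<zero>\<^bsub>Q\<^esub>"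
  obtains c where "c \<in> carrier R" "z = scalar c \<otimes>\<^bsub>Q\<^esub> y"
proof -
  have yz: "quat_conj y \<otimes>\<^bsub>Q\<^esub> z = \<zero>\<^bsub>Q\<^esub>"
    by (rule conj_mult_eq_zero[OF x y(1) z left])
  have "quat_conj w \<otimes>\<^bsub>Q\<^esub> quat_conj y = \<zero>\<^bsub>Q\<^esub>" "quat_conj w \<otimes>\<^bsub>Q\<^esub> quat_conj z = \<zero>\<^bsub>Q\<^esub>" "quat_conj w \<noteq> \<zero>\<^bsub>Q\<^esub>"
    using y z w right conj_conj[of w] by (auto simp: conj_zero simp flip: conj_mult)
  then have "quat_conj (quat_conj y) \<otimes>\<^bsub>Q\<^esub> quat_conj z = \<zero>\<^bsub>Q\<^esub>"
    using y(1) z w(1) conj_mult_eq_zero[of "quat_conj w" "quat_conj y" "quat_conj z"]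
    by (simp add: conj_closed)
  then have zy: "y \<otimes>\<^bsub>Q\<^esub> quat_conj z = \<zero>\<^bsub>Q\<^esub>" using y by (simp add: conj_conj)
  obtain u where u: "u \<in> carrier Q" "quat_trace (y \<otimes>\<^bsub>Q\<^esub> u) \<noteq> \<zero>"
    using trace_nondegenerate[OF y(1)] y(2) by blast
  define s t where "s = quat_trace (y \<otimes>\<^bsub>Q\<^esub> u)" and "t = quat_trace (u \<otimes>\<^bsub>Q\<^esub> z)"
  have st: "s \<in> carrier R" "t \<in> carrier R" "s \<noteq> \<zero>"
    using u y z by (auto simp: s_def t_def trace_closed)
  have "scalar s \<otimes>\<^bsub>Q\<^esub> z = (y \<otimes>\<^bsub>Q\<^esub> u \<oplus>\<^bsub>Q\<^esub> quat_conj u \<otimes>\<^bsub>Q\<^esub> quat_conj y) \<otimes>\<^bsub>Q\<^esub> z"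
    using u y by (simp add: s_def conj_mult flip: add_conj)
  also have "\<dots> = y \<otimes>\<^bsub>Q\<^esub> u \<otimes>\<^bsub>Q\<^esub> z"
    using u y z yz by (simp add: Q.l_distr Q.m_assoc conj_closed)
  also have "\<dots> = y \<otimes>\<^bsub>Q\<^esub> (u \<otimes>\<^bsub>Q\<^esub> z \<oplus>\<^bsub>Q\<^esub> quat_conj z \<otimes>\<^bsub>Q\<^esub> quat_conj u)"
    using u y z zy by (simp add: Q.r_distr conj_closed flip: Q.m_assoc)
  also have "\<dots> = y \<otimes>\<^bsub>Q\<^esub> scalar t"
    using u z by (simp add: t_def conj_mult flip: add_conj)
  also have "\<dots> = scalar t \<otimes>\<^bsub>Q\<^esub> y"
    using y st by (simp add: scalar_comm)
  finally have eq: "scalar s \<otimes>\<^bsub>Q\<^esub> z = scalar t \<otimes>\<^bsub>Q\<^esub> y" .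
  have inv: "inv s \<in> carrier R" "inv s \<otimes> s = \<one>" using st by (auto simp: field_Units)
  have "z = scalar (inv s \<otimes> s) \<otimes>\<^bsub>Q\<^esub> z"
    using inv z by (simp add: scalar_one)
  also have "\<dots> = scalar (inv s) \<otimes>\<^bsub>Q\<^esub> (scalar s \<otimes>\<^bsub>Q\<^esub> z)"
    using inv(1) st z by (simp add: scalar_closed Q.m_assoc flip: scalar_mult)
  also have "\<dots> = scalar (inv s \<otimes> t) \<otimes>\<^bsub>Q\<^esub> y"
    using inv(1) st y eq by (simp add: scalar_closed Q.m_assoc flip: scalar_mult)
  finally show ?thesis using that[of "inv s \<otimes> t"] inv st by simp
qed

lemma finite_quat_carrier:
  assumes "finite (carrier R)"
  shows "finite (carrier Q)"
proof (rule finite_subset)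
  let ?A = "carrier R"
  show "carrier Q \<subseteq> (\<lambda>(a, b, c, d). Quat a b c d) ` (?A \<times> ?A \<times> ?A \<times> ?A)"
  proof
    fix x assume "x \<in> carrier Q"
    then show "x \<in> (\<lambda>(a, b, c, d). Quat a b c d) ` (?A \<times> ?A \<times> ?A \<times> ?A)"
      by (cases x) (auto simp: Q_simps image_iff)
  qed
qed (use assms in simp)

text \<open>Two adjacent elements \<open>x\<close>, \<open>y\<close> of square zero satisfy \<open>x y = y x = 0\<close> by rectangularity, so they
  have common annihilators on both sides and are proportional.\<close>

lemma card_square_zero_le:
  assumes fin: "finite (carrier R)" and C: "C \<subseteq> carrier Q - {\<zero>\<^bsub>Q\<^esub>}"
    and clique: "\<And>x y. x \<in> C \<Longrightarrow> y \<in> C \<Longrightarrow> x \<noteq> y \<Longrightarrow> x \<otimes>\<^bsub>Q\<^esub> y = \<zero>\<^bsub>Q\<^esub> \<or> y \<otimes>\<^bsub>Q\<^esub> x = \<zero>\<^bsub>Q\<^esub>"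
  shows "card {x \<in> C. x \<otimes>\<^bsub>Q\<^esub> x = \<zero>\<^bsub>Q\<^esub>} \<le> card (carrier R) - 1"
proof (cases "{x \<in> C. x \<otimes>\<^bsub>Q\<^esub> x = \<zero>\<^bsub>Q\<^esub>} = {}")
  case False
  then obtain x where x: "x \<in> C" "x \<otimes>\<^bsub>Q\<^esub> x = \<zero>\<^bsub>Q\<^esub>" by blast
  have "{y \<in> C. y \<otimes>\<^bsub>Q\<^esub> y = \<zero>\<^bsub>Q\<^esub>} \<subseteq> (\<lambda>c. scalar c \<otimes>\<^bsub>Q\<^esub> x) ` (carrier R - {\<zero>})"
  proof
    fix y assume "y \<in> {y \<in> C. y \<otimes>\<^bsub>Q\<^esub> y = \<zero>\<^bsub>Q\<^esub>}"
    then have y: "y \<in> C" "y \<otimes>\<^bsub>Q\<^esub> y = \<zero>\<^bsub>Q\<^esub>" by auto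
    have Q_xy: "x \<in> carrier Q" "x \<noteq> \<zero>\<^bsub>Q\<^esub>" "y \<in> carrier Q" "y \<noteq> \<zero>\<^bsub>Q\<^esub>"
      using x(1) y(1) C by auto
    have "x \<otimes>\<^bsub>Q\<^esub> y = \<zero>\<^bsub>Q\<^esub> \<or> y \<otimes>\<^bsub>Q\<^esub> x = \<zero>\<^bsub>Q\<^esub>"
      using clique[of x y] x y by blast
    then have both: "x \<otimes>\<^bsub>Q\<^esub> y = \<zero>\<^bsub>Q\<^esub>" "y \<otimes>\<^bsub>Q\<^esub> x = \<zero>\<^bsub>Q\<^esub>"
      using mult_eq_zero_rectangular[of x y x y] mult_eq_zero_rectangular[of y x y x]
        x(2) y(2) Q_xy by blast+
    obtain c where c: "c \<in> carrier R" "y = scalar c \<otimes>\<^bsub>Q\<^esub> x"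
      using proportional_if_same_annihilators[of x x y x] x(2) Q_xy both by blast
    then have "c \<noteq> \<zero>" using y(1) x(1) C scalar_eq_zero_iff[of \<zero>] Q.l_null[of x] by (auto simp: subset_iff)
    then show "y \<in> (\<lambda>c. scalar c \<otimes>\<^bsub>Q\<^esub> x) ` (carrier R - {\<zero>})" using c by blast
  qed
  then have "card {x \<in> C. x \<otimes>\<^bsub>Q\<^esub> x = \<zero>\<^bsub>Q\<^esub>} \<le> card ((\<lambda>c. scalar c \<otimes>\<^bsub>Q\<^esub> x) ` (carrier R - {\<zero>}))"
    using fin by (intro card_mono) auto
  also have "\<dots> \<le> card (carrier R - {\<zero>})" using fin by (intro card_image_le) auto
  also have "\<dots> = card (carrier R) - 1" using fin by simp
  finally show ?thesis .
qed (simp only: card.empty le0)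

lemma card_clique_le:
  assumes fin: "finite (carrier R)"
    and V: "C \<subseteq> zero_divisors Q" and clique: "clique C (zero_divisor_edges Q)"
  shows "card C \<le> card (carrier R) + 1"
proof -
  have C: "C \<subseteq> carrier Q - {\<zero>\<^bsub>Q\<^esub>}" using V by (auto simp: zero_divisors_def)
  have adj: "x \<otimes>\<^bsub>Q\<^esub> y = \<zero>\<^bsub>Q\<^esub> \<or> y \<otimes>\<^bsub>Q\<^esub> x = \<zero>\<^bsub>Q\<^esub>" if "x \<in> C" "y \<in> C" "x \<noteq> y" for x y
    using clique that by (auto simp: clique_def zero_divisor_edges_def doubleton_eq_iff)
  have two: "2 \<le> card (carrier R)"
    using card_mono[of "carrier R" "{\<zero>, \<one>}"] fin by simp
  have "card C \<le> (card (carrier R) - 1) + 2"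
  proof (rule card_rectangular_clique_le[where Z = "\<lambda>x y. x \<otimes>\<^bsub>Q\<^esub> y = \<zero>\<^bsub>Q\<^esub>"])
    show "finite C" using C finite_quat_carrier[OF fin] finite_subset by blast
    show "w \<otimes>\<^bsub>Q\<^esub> z = \<zero>\<^bsub>Q\<^esub>" if "x \<in> C" "y \<in> C" "z \<in> C" "w \<in> C"
      "x \<otimes>\<^bsub>Q\<^esub> y = \<zero>\<^bsub>Q\<^esub>" "x \<otimes>\<^bsub>Q\<^esub> z = \<zero>\<^bsub>Q\<^esub>" "w \<otimes>\<^bsub>Q\<^esub> y = \<zero>\<^bsub>Q\<^esub>" for x y z w
      using mult_eq_zero_rectangular[of x y z w] that C by blast
  qed (use adj card_square_zero_le[OF fin C adj] two in auto)
  then show ?thesis using two by simp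
qed

text \<open>
  The element \<open>x = b i + c j + k\<close> is pure of norm zero, so its square is zero. The factor \<open>k\<close> is chosen
  because \<open>x k x = - 2 x\<close> is nonzero: this keeps \<open>x k\<close> and \<open>k x\<close> apart from each other and from the
  multiples of \<open>x\<close>.
\<close>

lemma ex_clique:
  assumes fin: "finite (carrier R)"
  obtains C where "C \<subseteq> zero_divisors Q" "clique C (zero_divisor_edges Q)"
    "card C = card (carrier R) + 1"
proof -
  obtain b c where bc: "b \<in> carrier R" "c \<in> carrier R" "b \<otimes> b \<oplus> c \<otimes> c \<oplus> \<one> = \<zero>"
    using ex_two_squares_plus_one[OF fin] .
  define x where "x = Quat \<zero> b c \<one>"
  define k where "k = Quat \<zero> \<zero> \<zero> \<one>"
  define m where "m = \<ominus> (\<one> \<oplus> \<one>)"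
  have x: "x \<in> carrier Q" "x \<noteq> \<zero>\<^bsub>Q\<^esub>" and k: "k \<in> carrier Q" and m: "m \<in> carrier R" "m \<noteq> \<zero>"
    using bc two_nonzero by (auto simp: x_def k_def m_def Q_simps)
  have sum_eq: "b \<otimes> b \<oplus> c \<otimes> c = \<ominus> \<one>"
    using minus_equality[of "b \<otimes> b \<oplus> c \<otimes> c" \<one>] bc by simp
  have sum_eq': "b \<otimes> b \<oplus> (c \<otimes> c \<oplus> r) = \<ominus> \<one> \<oplus> r" if "r \<in> carrier R" for r
    using that bc by (simp add: sum_eq flip: a_assoc)
  have neg_sum_eq: "\<ominus> (b \<otimes> b) \<oplus> \<ominus> (c \<otimes> c) = \<one>"
    using bc sum_eq by (simp flip: minus_add)
  have xx: "x \<otimes>\<^bsub>Q\<^esub> x = \<zero>\<^bsub>Q\<^esub>"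
    using bc neg_sum_eq by (simp add: x_def Q_simps quat_mult_def minus_eq r_neg l_neg m_comm)
  have xkx: "x \<otimes>\<^bsub>Q\<^esub> (k \<otimes>\<^bsub>Q\<^esub> x) = scalar m \<otimes>\<^bsub>Q\<^esub> x"
    using bc sum_eq sum_eq'
    by (simp add: x_def k_def m_def scalar_def Q_simps quat_mult_def minus_eq l_minus r_minus
        l_distr r_distr minus_add r_neg l_neg m_comm a_assoc)
  have kk: "k \<otimes>\<^bsub>Q\<^esub> k = \<ominus>\<^bsub>Q\<^esub> \<one>\<^bsub>Q\<^esub>"
    unfolding k_def by (rule quat_ring_relations) (rule is_cring)
  define y where "y = x \<otimes>\<^bsub>Q\<^esub> k"
  define z where "z = k \<otimes>\<^bsub>Q\<^esub> x"
  have yz: "y \<in> carrier Q" "z \<in> carrier Q" using x k by (auto simp: y_def z_def)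
  have "y \<otimes>\<^bsub>Q\<^esub> k = \<ominus>\<^bsub>Q\<^esub> x" "k \<otimes>\<^bsub>Q\<^esub> z = \<ominus>\<^bsub>Q\<^esub> x"
    using x k kk by (simp_all add: y_def z_def Q.m_assoc Q.r_minus)
     (simp add: Q.l_minus flip: Q.m_assoc)
  then have nz: "y \<noteq> \<zero>\<^bsub>Q\<^esub>" "z \<noteq> \<zero>\<^bsub>Q\<^esub>"
    using x k by (metis Q.l_null Q.r_null Q.minus_minus Q.minus_zero)+
  have xy: "x \<otimes>\<^bsub>Q\<^esub> y = \<zero>\<^bsub>Q\<^esub>" and zx: "z \<otimes>\<^bsub>Q\<^esub> x = \<zero>\<^bsub>Q\<^esub>" and zy: "z \<otimes>\<^bsub>Q\<^esub> y = \<zero>\<^bsub>Q\<^esub>"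
  proof -
    show xy: "x \<otimes>\<^bsub>Q\<^esub> y = \<zero>\<^bsub>Q\<^esub>" using x k xx by (simp add: y_def flip: Q.m_assoc)
    show "z \<otimes>\<^bsub>Q\<^esub> x = \<zero>\<^bsub>Q\<^esub>" using x k xx by (simp add: z_def Q.m_assoc)
    show "z \<otimes>\<^bsub>Q\<^esub> y = \<zero>\<^bsub>Q\<^esub>" using x k xy yz by (simp add: z_def Q.m_assoc)
  qed
  have xz: "x \<otimes>\<^bsub>Q\<^esub> z \<noteq> \<zero>\<^bsub>Q\<^esub>" and yx: "y \<otimes>\<^bsub>Q\<^esub> x \<noteq> \<zero>\<^bsub>Q\<^esub>"
    using scalar_mult_eq_zero[of m x] m x k xkx by (auto simp: z_def y_def Q.m_assoc)
  let ?f = "\<lambda>c. scalar c \<otimes>\<^bsub>Q\<^esub> x"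
  let ?N = "?f ` (carrier R - {\<zero>})"
  have f: "?f c \<in> carrier Q - {\<zero>\<^bsub>Q\<^esub>}" if "c \<in> carrier R - {\<zero>}" for c
    using that x scalar_mult_eq_zero[of c x] by (auto simp: scalar_closed)
  have f_left: "?f c \<otimes>\<^bsub>Q\<^esub> v = \<zero>\<^bsub>Q\<^esub>" if "c \<in> carrier R" "v \<in> carrier Q" "x \<otimes>\<^bsub>Q\<^esub> v = \<zero>\<^bsub>Q\<^esub>" for c v
    using that x by (simp add: Q.m_assoc scalar_closed)
  have f_right: "v \<otimes>\<^bsub>Q\<^esub> ?f c = \<zero>\<^bsub>Q\<^esub>" if "c \<in> carrier R" "v \<in> carrier Q" "v \<otimes>\<^bsub>Q\<^esub> x = \<zero>\<^bsub>Q\<^esub>" for c v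
    using that x by (simp add: scalar_comm scalar_closed flip: Q.m_assoc)
  have inj: "inj_on ?f (carrier R - {\<zero>})"
    by (rule inj_onI) (use bc in \<open>auto simp: x_def scalar_def Q_simps quat_mult_def minus_eq\<close>)
  define C where "C = insert y (insert z ?N)"
  have N: "v \<in> carrier Q" "v \<noteq> \<zero>\<^bsub>Q\<^esub>" "x \<otimes>\<^bsub>Q\<^esub> v = \<zero>\<^bsub>Q\<^esub>" "v \<otimes>\<^bsub>Q\<^esub> x = \<zero>\<^bsub>Q\<^esub>"
     "v \<otimes>\<^bsub>Q\<^esub> y = \<zero>\<^bsub>Q\<^esub>" "z \<otimes>\<^bsub>Q\<^esub> v = \<zero>\<^bsub>Q\<^esub>" "v' \<in> ?N \<Longrightarrow> v \<otimes>\<^bsub>Q\<^esub> v' = \<zero>\<^bsub>Q\<^esub>" if "v \<in> ?N" for v v'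
    using that f x yz xx xy zx by (auto intro!: f_left f_right)
  have zero_divisor: "v \<in> zero_divisors Q"
    if "v \<in> carrier Q" "v \<noteq> \<zero>\<^bsub>Q\<^esub>" "x \<otimes>\<^bsub>Q\<^esub> v = \<zero>\<^bsub>Q\<^esub> \<or> v \<otimes>\<^bsub>Q\<^esub> x = \<zero>\<^bsub>Q\<^esub>" for v
    using that x unfolding zero_divisors_def by blast
  have V: "C \<subseteq> zero_divisors Q"
    unfolding C_def insert_subset
  proof (intro conjI subsetI)
    show "y \<in> zero_divisors Q" "z \<in> zero_divisors Q"
      using yz nz xy zx by (auto intro: zero_divisor)
    show "v \<in> zero_divisors Q" if "v \<in> ?N" for v
      using N(1-3)[OF that] by (intro zero_divisor) auto
  qed
  have "clique C (zero_divisor_edges Q)"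
    unfolding clique_def
  proof (intro ballI impI)
    fix v w assume vw: "v \<in> C" "w \<in> C" "v \<noteq> w"
    have N_C: "s \<otimes>\<^bsub>Q\<^esub> t = \<zero>\<^bsub>Q\<^esub> \<or> t \<otimes>\<^bsub>Q\<^esub> s = \<zero>\<^bsub>Q\<^esub>" if "s \<in> ?N" "t \<in> C" for s t
      using that(2) N(5-7)[OF that(1)] unfolding C_def by (elim insertE) simp_all
    have "v \<in> ?N \<or> w \<in> ?N \<or> v = y \<and> w = z \<or> v = z \<and> w = y"
      using vw unfolding C_def by (elim insertE) simp_all
    then have "v \<otimes>\<^bsub>Q\<^esub> w = \<zero>\<^bsub>Q\<^esub> \<or> w \<otimes>\<^bsub>Q\<^esub> v = \<zero>\<^bsub>Q\<^esub>"
      using N_C[of v w] N_C[of w v] vw(1,2) zy by metis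
    then show "{v, w} \<in> zero_divisor_edges Q"
      using V vw unfolding zero_divisor_edges_def by blast
  qed
  moreover have "card C = card (carrier R) + 1"
  proof -
    have "y \<notin> ?N" "z \<notin> ?N" "y \<noteq> z" using N(3,4) xz yx xy by blast+
    moreover have "card ?N = card (carrier R) - 1"
      using inj fin by (simp add: card_image)
    moreover have "0 < card (carrier R)" using fin by (auto simp: card_gt_0_iff)
    ultimately show ?thesis using fin by (simp add: C_def)
  qed
  ultimately show ?thesis using V that by blast
qed

theorem clique_number_quat_ring:
  assumes fin: "finite (carrier R)"
  shows "clique_number (zero_divisors Q) (zero_divisor_edges Q) = card (carrier R) + 1"
  unfolding clique_number_def
proof (rule Max_eqI)
  have "finite (zero_divisors Q)"
    by (rule finite_subset[OF _ finite_quat_carrier[OF fin]]) (auto simp: zero_divisors_def)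
  then show "finite {card C |C. C \<subseteq> zero_divisors Q \<and> clique C (zero_divisor_edges Q)}"
    by simp
  show "n \<le> card (carrier R) + 1"
    if "n \<in> {card C |C. C \<subseteq> zero_divisors Q \<and> clique C (zero_divisor_edges Q)}" for n
    using that card_clique_le[OF fin] by blast
  obtain C where "C \<subseteq> zero_divisors Q" "clique C (zero_divisor_edges Q)"
    "card C = card (carrier R) + 1"
    using ex_clique[OF fin] .
  then show "card (carrier R) + 1 \<in> {card C |C. C \<subseteq> zero_divisors Q \<and> clique C (zero_divisor_edges Q)}"
    by (intro CollectI exI[of _ C]) simp
qed

end

section \<open>Lipschitz quaternions modulo an odd prime\<close>

theorem theorem3p6:
  fixes p :: nat
  assumes "prime p" and "odd p"
  shows "clique_number (zero_divisors (lipschitz_quat_mod p))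
           (zero_divisor_edges (lipschitz_quat_mod p)) = p + 1"
proof -
  interpret residues_prime p "residue_ring (int p)"
    by unfold_locales (use assms in auto)
  have "2 < p" using assms prime_gt_1_nat[of p] by (cases "p = 2") auto
  then interpret odd_field_quaternions "residue_ring (int p)"
    by unfold_locales (simp add: residue_ring_def)
  have "card (carrier (residue_ring (int p))) = p"
    by (simp add: residue_ring_def)
  moreover have "finite (carrier (residue_ring (int p)))"
    by (simp add: residue_ring_def)
  ultimately show ?thesis
    using clique_number_quat_ring by (simp add: lipschitz_quat_mod_def)
qed

end
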